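(* There exist countable incompressible dynamical systems $\langle\mathbb A,\alpha\rangle$ and $\langle\mathbb B,\beta\rangle$, an embedding $\iota$ of $\langle\mathbb A,\alpha\rangle$ into $\langle\mathbb B,\beta\rangle$, and an embedding $\eta$ of $\langle\mathbb A,\alpha\rangle$ into $\langle\mathcal P(\omega)/\mathrm{Fin},\sigma\rangle$, such that there is no embedding $\bar\eta$ of $\langle\mathbb B,\beta\rangle$ into $\langle\mathcal P(\omega)/\mathrm{Fin},\sigma\rangle$ with $\bar\eta\circ\iota=\eta$.
   Context: $\mathcal P(\omega)/\mathrm{Fin}$ is $\mathcal P(\omega)$ modulo finite sets, $[A]$ the class of $A$, and $\sigma([A])=[A+1]$ the shift automorphism. A dynamical system is a pair $\langle\mathbb A,\alpha\rangle$ with $\mathbb A$ a Boolean algebra and $\alpha$ an automorphism of $\mathbb A$. An embedding of $\langle\mathbb A,\alpha\rangle$ into $\langle\mathbb B,\beta\rangle$ is an injective Boolean homomorphism $\eta:\mathbb A\to\mathbb B$ with $\eta\circ\alpha=\beta\circ\eta$. A system $\langle\mathbb A,\alpha\rangle$ is incompressible if there is no $x\in\mathbb A\setminus\{\mathbf 0,\mathbf 1\}$ with $\alpha(x)\le x$. *)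

theory Defs
  imports "HOL-Algebra.Lattice" "HOL-Library.Countable_Set"
begin

section \<open>Boolean algebras on a carrier\<close>

text \<open>
  Algebras are given by a carrier, not by a type, so that they can be quantified existentially.
  Every countable algebra, finite or infinite, has an isomorphic copy whose carrier is a set of
  natural numbers, so \<^typ>\<open>nat gorder\<close> is general enough for countable algebras.
  The one-element algebra is admitted; it has no homomorphism into an algebra with
  \<open>\<bottom> \<noteq> \<top>\<close>.
\<close>

locale boolean_lattice = bounded_lattice +
  assumes meet_join_distrib:
    "\<lbrakk>x \<in> carrier L; y \<in> carrier L; z \<in> carrier L\<rbrakk> \<Longrightarrow> x \<sqinter> (y \<squnion> z) = (x \<sqinter> y) \<squnion> (x \<sqinter> z)"
    and complement_exists:
    "x \<in> carrier L \<Longrightarrow> \<exists>y\<in>carrier L. x \<sqinter> y = \<bottom> \<and> x \<squnion> y = \<top>"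

text \<open>Preservation of complements follows, complements being unique.\<close>

definition boolean_hom :: "'a gorder \<Rightarrow> 'b gorder \<Rightarrow> ('a \<Rightarrow> 'b) \<Rightarrow> bool" where
  "boolean_hom A B h \<longleftrightarrow>
     h \<in> carrier A \<rightarrow> carrier B \<and>
     join_pres A B h \<and> meet_pres A B h \<and>
     h \<bottom>\<^bsub>A\<^esub> = \<bottom>\<^bsub>B\<^esub> \<and> h \<top>\<^bsub>A\<^esub> = \<top>\<^bsub>B\<^esub>"

definition boolean_automorphism :: "'a gorder \<Rightarrow> ('a \<Rightarrow> 'a) \<Rightarrow> bool" where
  "boolean_automorphism A \<alpha> \<longleftrightarrow> boolean_hom A A \<alpha> \<and> bij_betw \<alpha> (carrier A) (carrier A)"

definition class_gorder :: "'a::order gorder" where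
  "class_gorder = \<lparr>carrier = UNIV, eq = (=), le = (\<le>)\<rparr>"


section \<open>Dynamical systems\<close>

definition dynamical_system :: "'a gorder \<Rightarrow> ('a \<Rightarrow> 'a) \<Rightarrow> bool" where
  "dynamical_system A \<alpha> \<longleftrightarrow> boolean_lattice A \<and> boolean_automorphism A \<alpha>"

definition embedding ::
  "'a gorder \<Rightarrow> ('a \<Rightarrow> 'a) \<Rightarrow> 'b gorder \<Rightarrow> ('b \<Rightarrow> 'b) \<Rightarrow> ('a \<Rightarrow> 'b) \<Rightarrow> bool" where
  "embedding A \<alpha> B \<beta> \<eta> \<longleftrightarrow>
     boolean_hom A B \<eta> \<and> inj_on \<eta> (carrier A) \<and> (\<forall>x\<in>carrier A. \<eta> (\<alpha> x) = \<beta> (\<eta> x))"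

definition incompressible :: "'a gorder \<Rightarrow> ('a \<Rightarrow> 'a) \<Rightarrow> bool" where
  "incompressible A \<alpha> \<longleftrightarrow> \<not> (\<exists>x \<in> carrier A - {\<bottom>\<^bsub>A\<^esub>, \<top>\<^bsub>A\<^esub>}. \<alpha> x \<sqsubseteq>\<^bsub>A\<^esub> x)"


section \<open>The power set of the natural numbers modulo finite sets, and the shift\<close>

definition almost_eq :: "nat set \<Rightarrow> nat set \<Rightarrow> bool" where
  "almost_eq X Y \<longleftrightarrow> finite (X - Y) \<and> finite (Y - X)"

quotient_type pow_fin = "nat set" / almost_eq
proof (rule equivpI)
  show "reflp almost_eq" "symp almost_eq"
    by (auto simp: almost_eq_def reflp_def symp_def)
  have "finite (X - Z)" if "finite (X - Y)" "finite (Y - Z)" for X Y Z :: "nat set"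
    by (rule finite_subset[of _ "(X - Y) \<union> (Y - Z)"]) (use that in auto)
  then show "transp almost_eq"
    unfolding almost_eq_def transp_def by blast
qed

instantiation pow_fin :: boolean_algebra
begin

lift_definition inf_pow_fin :: "pow_fin \<Rightarrow> pow_fin \<Rightarrow> pow_fin" is "(\<inter>)"
proof -
  fix X X' Y Y' :: "nat set" assume "almost_eq X X'" "almost_eq Y Y'"
  then have "finite ((X - X') \<union> (Y - Y'))" "finite ((X' - X) \<union> (Y' - Y))"
    by (auto simp: almost_eq_def)
  then show "almost_eq (X \<inter> Y) (X' \<inter> Y')"
    unfolding almost_eq_def by (intro conjI) (erule rev_finite_subset, blast)+
qed

lift_definition sup_pow_fin :: "pow_fin \<Rightarrow> pow_fin \<Rightarrow> pow_fin" is "(\<union>)"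
proof -
  fix X X' Y Y' :: "nat set" assume "almost_eq X X'" "almost_eq Y Y'"
  then have "finite ((X - X') \<union> (Y - Y'))" "finite ((X' - X) \<union> (Y' - Y))"
    by (auto simp: almost_eq_def)
  then show "almost_eq (X \<union> Y) (X' \<union> Y')"
    unfolding almost_eq_def by (intro conjI) (erule rev_finite_subset, blast)+
qed

lift_definition uminus_pow_fin :: "pow_fin \<Rightarrow> pow_fin" is "\<lambda>X. - X"
  by (auto simp: almost_eq_def Diff_eq Int_commute)

lift_definition minus_pow_fin :: "pow_fin \<Rightarrow> pow_fin \<Rightarrow> pow_fin" is "(-)"
proof -
  fix X X' Y Y' :: "nat set" assume "almost_eq X X'" "almost_eq Y Y'"
  then have "finite ((X - X') \<union> (Y' - Y))" "finite ((X' - X) \<union> (Y - Y'))"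
    by (auto simp: almost_eq_def)
  then show "almost_eq (X - Y) (X' - Y')"
    unfolding almost_eq_def by (intro conjI) (erule rev_finite_subset, blast)+
qed

lift_definition bot_pow_fin :: pow_fin is "{}" .

lift_definition top_pow_fin :: pow_fin is UNIV .

lift_definition less_eq_pow_fin :: "pow_fin \<Rightarrow> pow_fin \<Rightarrow> bool" is "\<lambda>X Y. finite (X - Y)"
proof -
  have *: "finite (X' - Y')"
    if "almost_eq X X'" "almost_eq Y Y'" "finite (X - Y)" for X X' Y Y'
    by (rule finite_subset[of _ "(X' - X) \<union> (X - Y) \<union> (Y - Y')"])
      (use that in \<open>auto simp: almost_eq_def\<close>)
  fix X X' Y Y' :: "nat set" assume "almost_eq X X'" "almost_eq Y Y'"
  moreover from this have "almost_eq X' X" "almost_eq Y' Y"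
    by (auto simp: almost_eq_def)
  ultimately show "finite (X - Y) = finite (X' - Y')"
    using * by blast
qed

definition less_pow_fin :: "pow_fin \<Rightarrow> pow_fin \<Rightarrow> bool" where
  "less_pow_fin x y \<longleftrightarrow> x \<le> y \<and> \<not> y \<le> x"

instance
proof
  fix x y z :: pow_fin
  show "x < y \<longleftrightarrow> x \<le> y \<and> \<not> y \<le> x"
    by (fact less_pow_fin_def)
  show "x \<le> x" by transfer simp
  show "x \<le> y \<Longrightarrow> y \<le> z \<Longrightarrow> x \<le> z"
  proof transfer
    fix X Y Z :: "nat set" assume "finite (X - Y)" "finite (Y - Z)"
    then have "finite ((X - Y) \<union> (Y - Z))"
      by simp
    then show "finite (X - Z)"
      by (rule rev_finite_subset) blast
  qed
  show "x \<le> y \<Longrightarrow> y \<le> x \<Longrightarrow> x = y"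
    by transfer (simp add: almost_eq_def)
  show "Lattices.inf x y \<le> x" "Lattices.inf x y \<le> y"
    by (transfer; simp add: Diff_eq Int_assoc Int_left_commute)+
  show "x \<le> y \<Longrightarrow> x \<le> z \<Longrightarrow> x \<le> Lattices.inf y z"
    by transfer (simp add: Diff_Int)
  show "x \<le> Lattices.sup x y" "y \<le> Lattices.sup x y"
    by (transfer; simp add: Diff_eq)+
  show "y \<le> x \<Longrightarrow> z \<le> x \<Longrightarrow> Lattices.sup y z \<le> x"
    by transfer (simp add: Un_Diff)
  show "Orderings.bot \<le> x" "x \<le> Orderings.top"
    by (transfer; simp)+
  show "Lattices.sup x (Lattices.inf y z) = Lattices.inf (Lattices.sup x y) (Lattices.sup x z)"
    by transfer (simp add: almost_eq_def Un_Int_distrib)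
  show "Lattices.inf x (- x) = Orderings.bot" "Lattices.sup x (- x) = Orderings.top"
    by (transfer; simp add: almost_eq_def)+
  show "x - y = Lattices.inf x (- y)"
    by transfer (simp add: almost_eq_def Diff_eq)
qed

end

lift_definition shift :: "pow_fin \<Rightarrow> pow_fin" is "\<lambda>X. (\<lambda>n. n + 1) ` X"
proof -
  fix X Y :: "nat set" assume "almost_eq X Y"
  then show "almost_eq ((\<lambda>n. n + 1) ` X) ((\<lambda>n. n + 1) ` Y)"
    unfolding almost_eq_def by (simp add: image_set_diff[symmetric])
qed


section \<open>Well-definedness\<close>

text \<open>
  The carrier-based operations agree with those of the type class, and the pair consisting of
  \<^typ>\<open>pow_fin\<close> and \<^const>\<open>shift\<close> is a dynamical system.
\<close>

lemma class_gorder_simps [simp]: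
  "carrier class_gorder = UNIV" "eq class_gorder = (=)" "le class_gorder = (\<le>)"
  by (simp_all add: class_gorder_def)

lemma class_gorder_join [simp]: "x \<squnion>\<^bsub>class_gorder\<^esub> y = Lattices.sup x (y::'a::lattice)"
proof -
  have "least class_gorder z (Upper class_gorder {x, y}) \<longleftrightarrow> z = Lattices.sup x y" for z
  proof
    assume "least class_gorder z (Upper class_gorder {x, y})"
    then have "x \<le> z" "y \<le> z" "z \<le> Lattices.sup x y"
      by (simp_all add: least_def Upper_def)
    then show "z = Lattices.sup x y"
      by (simp add: order.antisym)
  qed (simp add: least_def Upper_def)
  then show ?thesis
    by (simp add: join_def Lattice.sup_def)
qed

lemma class_gorder_meet [simp]: "x \<sqinter>\<^bsub>class_gorder\<^esub> y = Lattices.inf x (y::'a::lattice)"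
proof -
  have "greatest class_gorder z (Lower class_gorder {x, y}) \<longleftrightarrow> z = Lattices.inf x y" for z
  proof
    assume "greatest class_gorder z (Lower class_gorder {x, y})"
    then have "z \<le> x" "z \<le> y" "Lattices.inf x y \<le> z"
      by (simp_all add: greatest_def Lower_def)
    then show "z = Lattices.inf x y"
      by (simp add: order.antisym)
  qed (simp add: greatest_def Lower_def)
  then show ?thesis
    by (simp add: meet_def Lattice.inf_def)
qed

lemma class_gorder_bottom [simp]: "\<bottom>\<^bsub>class_gorder\<^esub> = (Orderings.bot::'a::order_bot)"
proof -
  have "least class_gorder z UNIV \<longleftrightarrow> z = Orderings.bot" for z :: 'a
    by (metis UNIV_I bot.extremum bot.extremum_uniqueI class_gorder_simps(1,3) least_def subset_UNIV)
  then show ?thesis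
    by (simp add: bottom_def)
qed

lemma class_gorder_top [simp]: "\<top>\<^bsub>class_gorder\<^esub> = (Orderings.top::'a::order_top)"
proof -
  have "greatest class_gorder z UNIV \<longleftrightarrow> z = Orderings.top" for z :: 'a
    by (metis UNIV_I top.extremum top.extremum_uniqueI class_gorder_simps(1,3) greatest_def subset_UNIV)
  then show ?thesis
    by (simp add: Order.top_def)
qed

lemma boolean_lattice_class_gorder: "boolean_lattice (class_gorder :: 'a::boolean_algebra gorder)"
proof unfold_locales
  fix x y :: 'a
  show "\<exists>s. least class_gorder s (Upper class_gorder {x, y})"
    by (rule exI[of _ "Lattices.sup x y"]) (auto simp: least_def Upper_def)
  show "\<exists>s. greatest class_gorder s (Lower class_gorder {x, y})"
    by (rule exI[of _ "Lattices.inf x y"]) (auto simp: greatest_def Lower_def)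
  show "\<exists>x. least class_gorder (x::'a) (carrier class_gorder)"
    by (rule exI[of _ "Orderings.bot"]) (auto simp: least_def)
  show "\<exists>x. greatest class_gorder (x::'a) (carrier class_gorder)"
    by (rule exI[of _ "Orderings.top"]) (auto simp: greatest_def)
  show "\<exists>y\<in>carrier class_gorder. x \<sqinter>\<^bsub>class_gorder\<^esub> y = \<bottom>\<^bsub>class_gorder\<^esub> \<and>
          x \<squnion>\<^bsub>class_gorder\<^esub> y = \<top>\<^bsub>class_gorder\<^esub>"
    by (rule bexI[of _ "- x"]) auto
qed (auto simp: inf_sup_distrib1)

lemma dynamical_system_pow_fin: "dynamical_system class_gorder shift"
proof -
  interpret boolean_lattice "class_gorder :: pow_fin gorder"
    by (rule boolean_lattice_class_gorder)
  have lat: "Lattice.lattice (class_gorder :: pow_fin gorder)" ..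
  have "boolean_hom class_gorder class_gorder shift"
    unfolding boolean_hom_def join_pres_def meet_pres_def
  proof (simp add: lat, intro conjI allI)
    fix x y :: pow_fin
    show "shift (Lattices.sup x y) = Lattices.sup (shift x) (shift y)"
      by transfer (auto simp: almost_eq_def image_Un)
    show "shift (Lattices.inf x y) = Lattices.inf (shift x) (shift y)"
      by transfer (auto simp: almost_eq_def image_Int)
    show "shift Orderings.bot = Orderings.bot"
      by transfer (simp add: almost_eq_def)
    have "UNIV - range Suc = {0}"
      by (auto simp: image_iff) (metis not0_implies_Suc)
    then show "shift Orderings.top = Orderings.top"
      by transfer (simp add: almost_eq_def)
  qed
  moreover have "inj shift"
  proof (rule injI)
    fix x y :: pow_fin
    show "shift x = shift y \<Longrightarrow> x = y"
      by transfer (auto simp: almost_eq_def image_set_diff[symmetric] dest: finite_imageD)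
  qed
  moreover have "surj shift"
  proof (rule surjI)
    define f where "f y = abs_pow_fin ((\<lambda>n. n + 1) -` rep_pow_fin y)" for y
    fix y :: pow_fin
    have eq: "(\<lambda>n. n + 1) ` ((\<lambda>n. n + 1) -` Y) = Y - {0::nat}" for Y
      by (auto simp: image_iff) (metis Suc_pred)
    have "shift (f y) = abs_pow_fin (rep_pow_fin y - {0})"
      by (simp only: f_def shift.abs_eq eq)
    also have "\<dots> = abs_pow_fin (rep_pow_fin y)"
      unfolding pow_fin.abs_eq_iff almost_eq_def
      by (auto intro: finite_subset[of _ "{0}"])
    also have "\<dots> = y"
      by (rule Quotient_abs_rep[OF Quotient_pow_fin])
    finally show "shift (f y) = y" .
  qed
  ultimately show ?thesis
    unfolding dynamical_system_def boolean_automorphism_def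
    using boolean_lattice_class_gorder by (simp add: bij_betw_def)
qed

end

theory Submission
  imports Defs "HOL-Library.Discrete_Functions"
begin

text \<open>
  Under Stone duality the two systems are countable compact spaces. The space of \<open>\<bbbA>\<close> is the
  one-point compactification of two copies of \<open>\<int>\<close> (indexed by \<^typ>\<open>bool\<close>), both translated
  by \<open>1\<close>; \<open>\<bbbB>\<close> splits the point at infinity into two fixed points, in such a way that one copy
  runs from the first to the second and the other copy runs back. An embedding into
  \<open>\<P>(\<omega>)/Fin\<close> is an asymptotic pseudo-orbit with dense limit set. In the space of \<open>\<bbbA>\<close> such an
  orbit may run through the same copy twice in a row; in the space of \<open>\<bbbB>\<close> the two copies must
  alternate. So an orbit that follows one copy twice in a row infinitely often does not lift.
\<close>

section \<open>Countable fields of sets as algebras on natural numbers\<close>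

text \<open>The carrier has to live in \<open>nat\<close>, so members of a countable
  \<open>C\<close> are coded by an enumeration; the order is inclusion pulled back along
  decoding.\<close>

definition set_order :: "'a set set \<Rightarrow> nat gorder" where
  "set_order C = \<lparr>carrier = to_nat_on C ` C, eq = (=),
     le = (\<lambda>x y. from_nat_into C x \<subseteq> from_nat_into C y)\<rparr>"

locale countable_field =
  fixes C :: "'a set set"
  assumes countable: "countable C"
    and empty: "{} \<in> C"
    and Un: "S \<in> C \<Longrightarrow> T \<in> C \<Longrightarrow> S \<union> T \<in> C"
    and Compl: "S \<in> C \<Longrightarrow> - S \<in> C"
begin

abbreviation "enc \<equiv> to_nat_on C"
abbreviation "dec \<equiv> from_nat_into C"

lemma Int: "S \<in> C \<Longrightarrow> T \<in> C \<Longrightarrow> S \<inter> T \<in> C"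
  using Un[of "- S" "- T"] Compl[of S] Compl[of T] Compl[of "- S \<union> - T"] by simp

lemma UNIV: "UNIV \<in> C"
  using Compl[OF empty] by simp

lemma dec_enc [simp]: "S \<in> C \<Longrightarrow> dec (enc S) = S"
  by (rule from_nat_into_to_nat_on[OF countable])

lemma carrier_set_order: "carrier (set_order C) = enc ` C"
  by (simp add: set_order_def)

lemma enc_eq_iff [simp]: "S \<in> C \<Longrightarrow> T \<in> C \<Longrightarrow> enc S = enc T \<longleftrightarrow> S = T"
  using dec_enc by metis

lemma le_set_order: "S \<in> C \<Longrightarrow> T \<in> C \<Longrightarrow> enc S \<sqsubseteq>\<^bsub>set_order C\<^esub> enc T \<longleftrightarrow> S \<subseteq> T"
  by (simp add: set_order_def)

lemma partial_order_set_order: "partial_order (set_order C)"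
  by unfold_locales (auto simp: set_order_def)

lemma least_Upper:
  assumes "S \<in> C" "T \<in> C"
  shows "least (set_order C) (enc (S \<union> T)) (Upper (set_order C) {enc S, enc T})"
  using assms Un[OF assms]
  by (auto simp: least_def Upper_def carrier_set_order le_set_order)

lemma greatest_Lower:
  assumes "S \<in> C" "T \<in> C"
  shows "greatest (set_order C) (enc (S \<inter> T)) (Lower (set_order C) {enc S, enc T})"
  using assms Int[OF assms]
  by (auto simp: greatest_def Lower_def carrier_set_order le_set_order)

lemma least_carrier: "least (set_order C) (enc {}) (carrier (set_order C))"
  using empty by (auto simp: least_def carrier_set_order le_set_order)

lemma greatest_carrier: "greatest (set_order C) (enc UNIV) (carrier (set_order C))"
  using UNIV by (auto simp: greatest_def carrier_set_order le_set_order)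

lemma join_set_order: "S \<in> C \<Longrightarrow> T \<in> C \<Longrightarrow> enc S \<squnion>\<^bsub>set_order C\<^esub> enc T = enc (S \<union> T)"
  unfolding join_def sup_def
  by (rule some_equality)
    (auto intro: least_Upper partial_order.least_unique[OF partial_order_set_order])

lemma meet_set_order: "S \<in> C \<Longrightarrow> T \<in> C \<Longrightarrow> enc S \<sqinter>\<^bsub>set_order C\<^esub> enc T = enc (S \<inter> T)"
  unfolding meet_def inf_def
  by (rule some_equality)
    (auto intro: greatest_Lower partial_order.greatest_unique[OF partial_order_set_order])

lemma bottom_set_order: "\<bottom>\<^bsub>set_order C\<^esub> = enc {}"
  unfolding bottom_def
  by (rule some_equality)
    (auto intro: least_carrier partial_order.least_unique[OF partial_order_set_order])

lemma top_set_order: "\<top>\<^bsub>set_order C\<^esub> = enc UNIV"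
  unfolding Order.top_def
  by (rule some_equality)
    (auto intro: greatest_carrier partial_order.greatest_unique[OF partial_order_set_order])

lemmas set_order_simps =
  carrier_set_order le_set_order join_set_order meet_set_order bottom_set_order top_set_order

lemma boolean_lattice_set_order: "boolean_lattice (set_order C)"
proof -
  interpret partial_order "set_order C"
    by (rule partial_order_set_order)
  show ?thesis
  proof unfold_locales
    fix x y assume "x \<in> carrier (set_order C)" "y \<in> carrier (set_order C)"
    then obtain S T where "S \<in> C" "T \<in> C" "x = enc S" "y = enc T"
      by (auto simp: carrier_set_order)
    then show "\<exists>s. least (set_order C) s (Upper (set_order C) {x, y})"
      and "\<exists>s. greatest (set_order C) s (Lower (set_order C) {x, y})"
      using least_Upper greatest_Lower by blast+
  next
    fix x y z
    assume "x \<in> carrier (set_order C)" "y \<in> carrier (set_order C)" "z \<in> carrier (set_order C)"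
    then show "x \<sqinter>\<^bsub>set_order C\<^esub> (y \<squnion>\<^bsub>set_order C\<^esub> z) =
        (x \<sqinter>\<^bsub>set_order C\<^esub> y) \<squnion>\<^bsub>set_order C\<^esub> (x \<sqinter>\<^bsub>set_order C\<^esub> z)"
      by (auto simp: set_order_simps Un Int Int_Un_distrib)
  next
    fix x assume "x \<in> carrier (set_order C)"
    then obtain S where "S \<in> C" "x = enc S"
      by (auto simp: carrier_set_order)
    then show "\<exists>y\<in>carrier (set_order C).
        x \<sqinter>\<^bsub>set_order C\<^esub> y = \<bottom>\<^bsub>set_order C\<^esub> \<and> x \<squnion>\<^bsub>set_order C\<^esub> y = \<top>\<^bsub>set_order C\<^esub>"
      by (intro bexI[of _ "enc (- S)"]) (auto simp: set_order_simps Compl)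
  qed (use least_carrier greatest_carrier in blast)+
qed

lemma lattice_set_order: "lattice (set_order C)"
  using boolean_lattice_set_order
  by (simp add: boolean_lattice_def bounded_lattice_def)

lemma incompressible_set_order:
  assumes "\<And>S. S \<in> C \<Longrightarrow> f S \<in> C"
    and "\<And>S. S \<in> C \<Longrightarrow> f S \<subseteq> S \<Longrightarrow> S = {} \<or> S = UNIV"
  shows "incompressible (set_order C) (enc \<circ> f \<circ> dec)"
  unfolding incompressible_def by (auto simp: set_order_simps assms(1) dest: assms(2))

end

text \<open>Preimages under any map respect unions and intersections, so only closure has to be
  checked.\<close>

lemma boolean_hom_set_order:
  assumes C: "countable_field C" and D: "countable_field D"
    and closed: "\<And>S. S \<in> C \<Longrightarrow> g -` S \<in> D"
  shows "boolean_hom (set_order C) (set_order D) (to_nat_on D \<circ> (-`) g \<circ> from_nat_into C)"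
proof -
  interpret C: countable_field C by (rule C)
  interpret D: countable_field D by (rule D)
  show ?thesis
    by (auto simp: boolean_hom_def join_pres_def meet_pres_def C.lattice_set_order
        D.lattice_set_order C.set_order_simps D.set_order_simps closed C.Un C.Int
        C.UNIV C.empty)
qed

lemma dynamical_system_set_order:
  assumes C: "countable_field C" and "bij g"
    and closed: "\<And>S. S \<in> C \<Longrightarrow> g -` S \<in> C" "\<And>S. S \<in> C \<Longrightarrow> g ` S \<in> C"
  shows "dynamical_system (set_order C) (to_nat_on C \<circ> (-`) g \<circ> from_nat_into C)"
proof -
  interpret countable_field C by (rule C)
  let ?a = "enc \<circ> (-`) g \<circ> dec"
  have "S = T" if "g -` S = g -` T" for S T
    using that surj_image_vimage_eq[OF bij_is_surj[OF \<open>bij g\<close>]] by metis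
  then have "inj_on ?a (enc ` C)"
    by (simp add: inj_on_def closed)
  moreover have "?a ` enc ` C = enc ` C"
  proof (intro equalityI subsetI)
    fix x assume "x \<in> enc ` C"
    then obtain S where S: "S \<in> C" "x = enc S" by auto
    then have "x = ?a (enc (g ` S))"
      using \<open>bij g\<close> by (simp add: closed bij_def inj_vimage_image_eq)
    then show "x \<in> ?a ` enc ` C"
      using S closed(2) by blast
  qed (auto simp: closed)
  ultimately show ?thesis
    using boolean_lattice_set_order boolean_hom_set_order[OF C C closed(1)]
    by (simp add: dynamical_system_def boolean_automorphism_def bij_betw_def carrier_set_order)
qed

lemma embedding_set_order_subset:
  assumes C: "countable_field C" and D: "countable_field D" and "C \<subseteq> D"
    and closed: "\<And>S. S \<in> C \<Longrightarrow> f S \<in> C"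
  shows "embedding (set_order C) (to_nat_on C \<circ> f \<circ> from_nat_into C)
    (set_order D) (to_nat_on D \<circ> f \<circ> from_nat_into D) (to_nat_on D \<circ> from_nat_into C)"
proof -
  interpret C: countable_field C by (rule C)
  interpret D: countable_field D by (rule D)
  \<comment> \<open>The inclusion is the preimage map of the identity.\<close>
  have "boolean_hom (set_order C) (set_order D) (to_nat_on D \<circ> (-`) id \<circ> from_nat_into C)"
    using C D by (rule boolean_hom_set_order) (use \<open>C \<subseteq> D\<close> in auto)
  moreover have "((-`) id :: 'a set \<Rightarrow> 'a set) = id"
    by auto
  ultimately show ?thesis
    using \<open>C \<subseteq> D\<close>
    by (auto simp: embedding_def inj_on_def C.carrier_set_order closed subset_iff)
qed

text \<open>A set is sent to the times at which the sequence \<open>x\<close> visits it. Infinitely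
  many visits to every point give injectivity. By \<open>orbit\<close>, \<open>g (x (Suc m))\<close>
  and \<open>x m\<close> agree on membership in \<open>S\<close> for almost all \<open>m\<close>,
  which is commutation with \<open>shift\<close>.\<close>

lemma embedding_set_order_pow_fin:
  assumes C: "countable_field C"
    and closed: "\<And>S. S \<in> C \<Longrightarrow> g -` S \<in> C"
    and dense: "\<And>p. infinite (x -` {p})"
    and orbit: "\<And>S. S \<in> C \<Longrightarrow> almost_eq (x -` (g -` S)) (Suc ` (x -` S))"
  shows "embedding (set_order C) (to_nat_on C \<circ> (-`) g \<circ> from_nat_into C)
    class_gorder shift (abs_pow_fin \<circ> (-`) x \<circ> from_nat_into C)"
proof -
  interpret C: countable_field C by (rule C)
  interpret P: boolean_lattice "class_gorder :: pow_fin gorder"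
    by (rule boolean_lattice_class_gorder)
  have lat: "lattice (class_gorder :: pow_fin gorder)" ..
  have inj: "S \<subseteq> T" if "finite (x -` S - x -` T)" for S T
  proof
    fix p assume "p \<in> S"
    show "p \<in> T"
    proof (rule ccontr)
      assume "p \<notin> T"
      with \<open>p \<in> S\<close> have "x -` {p} \<subseteq> x -` S - x -` T" by auto
      with that dense show False using finite_subset by blast
    qed
  qed
  have "abs_pow_fin (x -` S) = abs_pow_fin (x -` T) \<Longrightarrow> S = T" for S T
    using inj[of S T] inj[of T S] by (simp add: pow_fin.abs_eq_iff almost_eq_def)
  moreover have "abs_pow_fin (x -` (g -` S)) = shift (abs_pow_fin (x -` S))" if "S \<in> C" for S
    using orbit[OF that] by (simp add: pow_fin.abs_eq_iff shift.abs_eq)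
  ultimately show ?thesis
    unfolding embedding_def boolean_hom_def join_pres_def meet_pres_def inj_on_def
    by (simp add: C.lattice_set_order lat C.set_order_simps closed C.Un C.Int C.UNIV C.empty
        inf_pow_fin.abs_eq sup_pow_fin.abs_eq bot_pow_fin_def top_pow_fin_def)
qed


section \<open>The two systems\<close>

text \<open>Preimages under the predecessor move sets forward by 1, the direction in which
  \<open>shift\<close> moves sets of times.\<close>

definition pred :: "int \<times> bool \<Rightarrow> int \<times> bool" where
  "pred p = (fst p - 1, snd p)"

definition almost :: "'a set set \<Rightarrow> 'a set set" where
  "almost \<T> = {S. \<exists>T\<in>\<T>. finite (sym_diff S T)}"

text \<open>
  The clopen neighbourhood of the fixed point that the copy \<^const>\<open>True\<close> approaches in the future
  and the copy \<^const>\<open>False\<close> in the past.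
\<close>

definition zigzag :: "(int \<times> bool) set" where
  "zigzag = {p. if snd p then 0 \<le> fst p else fst p < 0}"

text \<open>This is the finite-cofinite algebra.\<close>

definition algA :: "(int \<times> bool) set set" where
  "algA = almost {{}, UNIV}"

definition algB :: "(int \<times> bool) set set" where
  "algB = almost {{}, UNIV, zigzag, - zigzag}"

lemma countable_field_almost:
  fixes \<T> :: "'a::countable set set"
  assumes "finite \<T>" and "{} \<in> \<T>"
    and Un: "\<And>S T. S \<in> \<T> \<Longrightarrow> T \<in> \<T> \<Longrightarrow> S \<union> T \<in> \<T>"
    and Compl: "\<And>S. S \<in> \<T> \<Longrightarrow> - S \<in> \<T>"
  shows "countable_field (almost \<T>)"
proof
  \<comment> \<open>A member is recovered from its approximant in \<open>\<T>\<close> and their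
    finite difference.\<close>
  have "almost \<T> \<subseteq> (\<lambda>(T, F). sym_diff T F) ` (\<T> \<times> Collect finite)"
  proof
    fix S assume "S \<in> almost \<T>"
    then obtain T where "T \<in> \<T>" "finite (sym_diff S T)" by (auto simp: almost_def)
    moreover have "S = sym_diff T (sym_diff S T)" by auto
    ultimately show "S \<in> (\<lambda>(T, F). sym_diff T F) ` (\<T> \<times> Collect finite)" by blast
  qed
  moreover have "countable (Collect finite :: 'a set set)"
    using countable_Collect_finite .
  ultimately show "countable (almost \<T>)"
    using \<open>finite \<T>\<close> by (meson countable_SIGMA countable_finite countable_image countable_subset)
next
  show "{} \<in> almost \<T>"
    using assms(2) by (force simp: almost_def)
next
  fix S S' assume "S \<in> almost \<T>" "S' \<in> almost \<T>"
  then obtain T T' where T: "T \<in> \<T>" "T' \<in> \<T>" "finite (sym_diff S T \<union> sym_diff S' T')"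
    by (auto simp: almost_def)
  have "finite (sym_diff (S \<union> S') (T \<union> T'))"
    by (rule finite_subset[OF _ T(3)]) auto
  then show "S \<union> S' \<in> almost \<T>"
    using T Un by (auto simp: almost_def)
next
  fix S assume "S \<in> almost \<T>"
  then obtain T where T: "T \<in> \<T>" "finite (sym_diff S T)"
    by (auto simp: almost_def)
  have "sym_diff (- S) (- T) = sym_diff S T" by auto
  then show "- S \<in> almost \<T>"
    using T Compl by (metis (mono_tags, lifting) almost_def mem_Collect_eq)
qed

lemma almost_image_closed:
  assumes "inj g" and "\<And>T. T \<in> \<T> \<Longrightarrow> g ` T \<in> almost \<T>" and "S \<in> almost \<T>"
  shows "g ` S \<in> almost \<T>"
proof -
  obtain T where T: "T \<in> \<T>" "finite (sym_diff S T)"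
    using assms(3) by (auto simp: almost_def)
  obtain T' where T': "T' \<in> \<T>" "finite (sym_diff (g ` T) T')"
    using assms(2)[OF T(1)] by (auto simp: almost_def)
  have "finite (g ` sym_diff S T \<union> sym_diff (g ` T) T')"
    using T T' by blast
  then have "finite (sym_diff (g ` S) T')"
    by (rule finite_subset[rotated]) auto
  then show ?thesis
    using T' by (auto simp: almost_def)
qed

section \<open>Translation acting on the two algebras\<close>

lemma bij_pred: "bij pred"
  by (rule bij_betw_byWitness[where f' = "\<lambda>p. (fst p + 1, snd p)"]) (auto simp: pred_def)

lemma inv_pred: "inv pred p = (fst p + 1, snd p)"
  using bij_pred by (intro inv_f_eq) (auto simp: bij_def pred_def)

lemma vimage_pred: "pred -` S = inv pred ` S"
  using bij_pred by (simp add: bij_vimage_eq_inv_image)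

lemma image_pred: "pred ` S = inv pred -` S"
  using bij_imp_bij_inv[OF bij_pred] by (simp add: bij_vimage_eq_inv_image inv_inv_eq bij_pred)

lemma surj_pred: "range pred = UNIV" and surj_inv_pred: "range (inv pred) = UNIV"
  using bij_pred bij_imp_bij_inv bij_is_surj by blast+

text \<open>Only points next to the threshold of \<open>zigzag\<close> change sides. Hence
  \<open>zigzag\<close> is translation invariant modulo finite sets, and both points at infinity are
  fixed.\<close>

lemma pred_zigzag: "sym_diff (pred ` zigzag) zigzag \<subseteq> {-1, 0} \<times> UNIV"
  unfolding image_pred by (auto simp: inv_pred zigzag_def split: if_splits)

lemma inv_pred_zigzag: "sym_diff (inv pred ` zigzag) zigzag \<subseteq> {0, 1} \<times> UNIV"
  unfolding vimage_pred[symmetric] by (auto simp: pred_def zigzag_def split: if_splits)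

lemma pred_algA: "S \<in> algA \<Longrightarrow> pred ` S \<in> algA"
  unfolding algA_def using bij_is_inj[OF bij_pred]
  by (rule almost_image_closed) (auto simp: surj_pred almost_def)

lemma vimage_pred_algA: "S \<in> algA \<Longrightarrow> pred -` S \<in> algA"
  unfolding algA_def vimage_pred using bij_is_inj[OF bij_imp_bij_inv[OF bij_pred]]
  by (rule almost_image_closed) (auto simp: surj_inv_pred almost_def)

lemma bij_image_algB:
  assumes "bij g" and zigzag: "finite (sym_diff (g ` zigzag) zigzag)" and "S \<in> algB"
  shows "g ` S \<in> algB"
proof -
  have image: "g ` T \<in> algB" if T: "T \<in> {{}, UNIV, zigzag, - zigzag}" for T
  proof -
    have Compl: "sym_diff (g ` (- zigzag)) (- zigzag) = sym_diff (g ` zigzag) zigzag"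
      unfolding bij_image_Compl_eq[OF \<open>bij g\<close>] by auto
    consider "T = {}" | "T = UNIV" | "T = zigzag" | "T = - zigzag"
      using T by blast
    then have "finite (sym_diff (g ` T) T)"
    proof cases
      case 4
      show ?thesis unfolding 4 Compl by (rule zigzag)
    qed (use zigzag bij_is_surj[OF \<open>bij g\<close>] in auto)
    then show ?thesis
      using T unfolding algB_def almost_def by blast
  qed
  show ?thesis
    using bij_is_inj[OF \<open>bij g\<close>] image \<open>S \<in> algB\<close> unfolding algB_def
    by (rule almost_image_closed)
qed

lemma pred_algB: "S \<in> algB \<Longrightarrow> pred ` S \<in> algB"
  using bij_pred finite_subset[OF pred_zigzag] by (intro bij_image_algB) auto

lemma vimage_pred_algB: "S \<in> algB \<Longrightarrow> pred -` S \<in> algB"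
  unfolding vimage_pred using bij_pred finite_subset[OF inv_pred_zigzag]
  by (intro bij_image_algB bij_imp_bij_inv) auto

lemma countable_field_algA: "countable_field algA"
  unfolding algA_def by (rule countable_field_almost) auto

lemma countable_field_algB: "countable_field algB"
  unfolding algB_def by (rule countable_field_almost) auto

lemma algA_subset_algB: "algA \<subseteq> algB"
  by (auto simp: algA_def algB_def almost_def)

text \<open>The hypothesis makes \<open>S\<close> closed upwards in each copy, so its behaviour at
  the two ends of a copy decides everything. Near infinity \<open>S\<close> agrees with one of four
  sets; \<open>zigzag\<close> and its complement are excluded because each is left by one of the two
  copies.\<close>

lemma upward_closed_algB:
  assumes "S \<in> algB" and "pred -` S \<subseteq> S"
  shows "S = {} \<or> S = UNIV"
proof -
  have step: "(n + 1, i) \<in> S" if "(n, i) \<in> S" for n i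
    using assms(2) that by (auto simp: pred_def)
  have up: "(m, i) \<in> S" if "(n, i) \<in> S" "n \<le> m" for m n i
    using that(2,1) by (induction rule: int_ge_induct) (auto intro: step)
  obtain T where T: "T \<in> {{}, UNIV, zigzag, - zigzag}" "finite (sym_diff S T)"
    using assms(1) unfolding algB_def almost_def by blast
  obtain N where N: "\<And>p. p \<in> sym_diff S T \<Longrightarrow> \<bar>fst p\<bar> < N"
  proof -
    have fin: "finite ((\<lambda>p. \<bar>fst p\<bar>) ` sym_diff S T)"
      using T(2) by (rule finite_imageI)
    then have "\<bar>fst p\<bar> < Max (insert 0 ((\<lambda>p. \<bar>fst p\<bar>) ` sym_diff S T)) + 1"
      if "p \<in> sym_diff S T" for p
      using that Max_ge[of "insert 0 ((\<lambda>p. \<bar>fst p\<bar>) ` sym_diff S T)" "\<bar>fst p\<bar>"]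
      by force
    then show thesis using that by blast
  qed
  have far: "(n, i) \<in> S \<longleftrightarrow> (n, i) \<in> T" if "N \<le> \<bar>n\<bar>" for n i
    using N[of "(n, i)"] that by auto
  \<comment> \<open>Start far enough down to be below \<open>n\<close> and in the region where
    \<open>S\<close> and \<open>T\<close> agree, then climb. The next fact climbs from
    \<open>n\<close> to the far future instead.\<close>
  have full: "(n, i) \<in> S" if "\<And>m. m < 0 \<Longrightarrow> (m, i) \<in> T" for n i
    using up[of "min n (- \<bar>N\<bar> - 1)" i n] that[of "min n (- \<bar>N\<bar> - 1)"]
      far[of "min n (- \<bar>N\<bar> - 1)" i] by auto
  have none: "(n, i) \<notin> S" if "\<And>m. m \<ge> 0 \<Longrightarrow> (m, i) \<notin> T" for n i
    using up[of n i "max n \<bar>N\<bar>"] that[of "max n \<bar>N\<bar>"] far[of "max n \<bar>N\<bar>" i] by auto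
  consider "T = {}" | "T = UNIV" | "T = zigzag" | "T = - zigzag"
    using T(1) by auto
  then show ?thesis
  proof cases
    case 1
    then show ?thesis using none by auto
  next
    case 2
    then show ?thesis using full by auto
  next
    \<comment> \<open>The copy \<open>False\<close> has its past in \<open>zigzag\<close> and its
      future outside, so \<open>full\<close> and \<open>none\<close> clash at position 0; in the
      last case the copy \<open>True\<close> does the same.\<close>
    case 3
    then show ?thesis using full[of False 0] none[of False 0] by (simp add: zigzag_def)
  next
    case 4
    then show ?thesis using full[of True 0] none[of True 0] by (simp add: zigzag_def)
  qed
qed


section \<open>A pseudo-orbit without a lift\<close>

text \<open>
  The \<open>k\<close>-th block \<open>{k\<^sup>2..<(k + 1)\<^sup>2}\<close> runs through the points from \<open>-k\<close> to \<open>k\<close> of one copy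
  of \<open>\<int>\<close>; the copies follow the pattern \<open>False, True, True\<close>.
\<close>

definition walk :: "nat \<Rightarrow> int \<times> bool" where
  "walk m = (let k = floor_sqrt m in (int m - int (k\<^sup>2 + k), \<not> 3 dvd k))"

text \<open>Times in block \<open>k\<close> are measured from its centre \<open>k^2 + k\<close>,
  where the walk is at position 0.\<close>

lemma walk_block:
  assumes "int m = int (k\<^sup>2 + k) + n" and "\<bar>n\<bar> \<le> int k"
  shows "walk m = (n, \<not> 3 dvd k)"
proof -
  have "k\<^sup>2 \<le> m" "m < k\<^sup>2 + 2 * k + 1"
    using assms by linarith+
  then have "floor_sqrt m = k"
    by (intro floor_sqrt_unique) (auto simp: power2_eq_square)
  then show ?thesis
    using assms by (simp add: walk_def)
qed

lemma infinite_walk: "infinite (walk -` {p})"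
proof -
  obtain n i where p: "p = (n, i)" by fastforce
  have "\<exists>m\<ge>N. m \<in> walk -` {p}" for N
  proof -
    \<comment> \<open>A block this late starts after \<open>N\<close> and is long enough to reach
      position \<open>n\<close>; the residue of \<open>k\<close> modulo 3 selects the copy
      \<open>i\<close>.\<close>
    define j where "j = N + nat \<bar>n\<bar>"
    define k where "k = 3 * j + (if i then 1 else 0)"
    define m where "m = nat (int (k\<^sup>2 + k) + n)"
    have i: "(\<not> 3 dvd k) = i"
      unfolding k_def by (cases i; simp; presburger)
    have k: "\<bar>n\<bar> \<le> int k" "N \<le> k"
      by (auto simp: j_def k_def)
    have "int k \<le> int (k\<^sup>2)"
      unfolding power2_eq_square of_nat_le_iff by (rule le_square)
    then have m: "int m = int (k\<^sup>2 + k) + n"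
      using k unfolding m_def by linarith
    then have "N \<le> m"
      using k \<open>int k \<le> int (k\<^sup>2)\<close> by linarith
    then show ?thesis
      using walk_block[OF m k(1)] i p by blast
  qed
  then show ?thesis
    by (simp add: infinite_nat_iff_unbounded_le)
qed

text \<open>Inside a block the walk follows the translation. Jumps occur only between blocks, with
  ends that escape to infinity; which copies they join is left open.\<close>

lemma walk_Suc: "pred (walk (Suc m)) = walk m \<or>
    (\<exists>k. Suc m = (Suc k)\<^sup>2 \<and> fst (walk m) = int k \<and> fst (walk (Suc m)) = - int (Suc k))"
proof -
  define k where "k = floor_sqrt m"
  have k: "k\<^sup>2 \<le> m" "m < (Suc k)\<^sup>2"
    using Suc_floor_sqrt_power2_gt by (auto simp: k_def)
  show ?thesis
  proof (cases "Suc m < (Suc k)\<^sup>2")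
    case True
    then have "floor_sqrt (Suc m) = k"
      using k by (intro floor_sqrt_unique) auto
    then show ?thesis
      by (simp add: walk_def pred_def k_def[symmetric] Let_def)
  next
    case False
    then have eq: "Suc m = (Suc k)\<^sup>2" using k by simp
    then have "floor_sqrt (Suc m) = Suc k" by simp
    then have "fst (walk (Suc m)) = int (Suc m) - int ((Suc k)\<^sup>2 + Suc k)"
      "fst (walk m) = int (Suc m) - 1 - int (k\<^sup>2 + k)"
      by (simp_all add: walk_def k_def Let_def)
    then show ?thesis
      using eq by (intro disjI2 exI[of _ k]) (simp add: eq power2_eq_square)
  qed
qed

lemma finite_jumps:
  assumes "finite S"
  shows "finite {m. pred (walk (Suc m)) \<noteq> walk m \<and> (pred (walk (Suc m)) \<in> S \<or> walk m \<in> S)}"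
    (is "finite ?J")
proof -
  \<comment> \<open>The jump at time \<open>(Suc k)^2 - 1\<close> leaves position \<open>k\<close>,
    and the predecessor of its target is at \<open>- k - 2\<close>. Either position determines
    \<open>k\<close>, so each point of \<open>S\<close> accounts for at most two jumps.\<close>
  have "?J \<subseteq> (\<lambda>p. (Suc (nat \<bar>fst p\<bar>))\<^sup>2 - 1) ` S \<union> (\<lambda>p. (nat (\<bar>fst p\<bar> - 1))\<^sup>2 - 1) ` S"
  proof
    fix m assume m: "m \<in> ?J"
    then obtain k where k: "Suc m = (Suc k)\<^sup>2" "fst (walk m) = int k"
      "fst (walk (Suc m)) = - int (Suc k)"
      using walk_Suc[of m] by auto
    then have "m = (Suc (nat \<bar>fst (walk m)\<bar>))\<^sup>2 - 1"
      "m = (nat (\<bar>fst (pred (walk (Suc m)))\<bar> - 1))\<^sup>2 - 1"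
      by (auto simp: pred_def nat_add_distrib)
    then show "m \<in> (\<lambda>p. (Suc (nat \<bar>fst p\<bar>))\<^sup>2 - 1) ` S \<union> (\<lambda>p. (nat (\<bar>fst p\<bar> - 1))\<^sup>2 - 1) ` S"
      using m by blast
  qed
  then show ?thesis
    using assms finite_subset by blast
qed

text \<open>A finite or cofinite set cannot distinguish the ends of a late jump, since both avoid
  the finite part.\<close>

lemma almost_eq_walk:
  assumes "S \<in> algA"
  shows "almost_eq (walk -` (pred -` S)) (Suc ` (walk -` S))"
proof -
  obtain F where F: "finite F" "S = F \<or> S = - F"
    using assms by (auto simp: algA_def almost_def Compl_eq_Diff_UNIV[symmetric])
  let ?J = "{m. pred (walk (Suc m)) \<noteq> walk m \<and> (pred (walk (Suc m)) \<in> F \<or> walk m \<in> F)}"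
  have *: "pred (walk (Suc m)) \<in> S \<longleftrightarrow> walk m \<in> S" if "m \<notin> ?J" for m
    using that F(2) by auto
  \<comment> \<open>Time 0 is listed apart, as it has no preceding time to compare with.\<close>
  have "sym_diff (walk -` (pred -` S)) (Suc ` (walk -` S)) \<subseteq> insert 0 (Suc ` ?J)"
  proof (rule subsetI, rule ccontr)
    fix m assume m: "m \<in> sym_diff (walk -` (pred -` S)) (Suc ` (walk -` S))"
      and "m \<notin> insert 0 (Suc ` ?J)"
    then obtain l where "m = Suc l" "l \<notin> ?J"
      by (metis (no_types, lifting) image_eqI insert_iff not0_implies_Suc)
    then show False
      using m *[of l] by auto
  qed
  then have "finite (sym_diff (walk -` (pred -` S)) (Suc ` (walk -` S)))"
    by (rule finite_subset) (use finite_jumps[OF F(1)] in blast)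
  then show ?thesis
    by (simp add: almost_eq_def)
qed

section \<open>The obstruction to a lift\<close>

lemma walk_centre: "fst (walk m) = 0 \<longleftrightarrow> m = (floor_sqrt m)\<^sup>2 + floor_sqrt m"
  by (simp only: walk_def Let_def fst_conv right_minus_eq of_nat_eq_iff)

text \<open>The bounds are consecutive block centres, the only times at position 0. Strictly between
  them nothing enters or leaves the set \<open>E\<close> considered below.\<close>

lemma no_centre_between:
  assumes "k\<^sup>2 + k < m" "m < (Suc k)\<^sup>2 + Suc k"
  shows "fst (walk m) \<noteq> 0"
proof
  define j where "j = floor_sqrt m"
  assume "fst (walk m) = 0"
  then have m: "m = j\<^sup>2 + j" by (simp add: walk_centre j_def)
  show False
  proof (cases "j \<le> k")
    case True
    then have "j\<^sup>2 \<le> k\<^sup>2" by (rule power_mono) simp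
    then show False using True assms(1) m by linarith
  next
    case False
    then have "(Suc k)\<^sup>2 \<le> j\<^sup>2" by (intro power_mono) auto
    then show False using False assms(2) m by linarith
  qed
qed

text \<open>
  \<open>E\<close> is the set of times at which a lift would be close to the fixed point of \<^const>\<open>zigzag\<close>:
  such a lift enters \<open>E\<close> exactly at the centres of the \<^const>\<open>True\<close> blocks and leaves it exactly
  at those of the \<^const>\<open>False\<close> blocks.
\<close>

lemma no_lift:
  fixes E :: "nat set"
  defines "P \<equiv> walk -` {(0, True)}" and "Q \<equiv> walk -` {(0, False)}"
  assumes "almost_eq (Suc ` E \<inter> P) {}" "almost_eq (E \<inter> Q) {}"
    and "almost_eq (Suc ` E \<union> P) (E \<union> Q)"
  shows False
proof -
  have "finite ((Suc ` E \<inter> P) \<union> (E \<inter> Q) \<union> sym_diff (Suc ` E \<union> P) (E \<union> Q))"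
    using assms by (auto simp: almost_eq_def)
  then obtain N where N: "m \<notin> (Suc ` E \<inter> P) \<union> (E \<inter> Q) \<union> sym_diff (Suc ` E \<union> P) (E \<union> Q)"
    if "N \<le> m" for m
    by (meson finite_nat_set_iff_bounded linorder_not_le)
  \<comment> \<open>Neither \<open>k\<close> nor \<open>Suc k\<close> is divisible by 3, so
    \<open>c\<close> and \<open>d\<close> are the centres of two successive \<open>True\<close>
    blocks, past the exceptions below \<open>N\<close>.\<close>
  define k where "k = 3 * N + 1"
  define c d where "c = k\<^sup>2 + k" and "d = (Suc k)\<^sup>2 + Suc k"
  have "walk c = (0, True)" "walk d = (0, True)"
    using walk_block[of c k 0] walk_block[of d "Suc k" 0]
    by (simp_all add: c_def d_def) (simp_all add: k_def, presburger+)
  then have PQ: "c \<in> P" "c \<notin> Q" "d \<in> P"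
    by (auto simp: P_def Q_def)
  have "N \<le> c" "c < d"
    by (auto simp: c_def d_def k_def power2_eq_square)
  \<comment> \<open>\<open>E\<close> is entered at \<open>c\<close> and cannot be left before
    \<open>d\<close>; entering it again at \<open>d\<close> is then impossible.\<close>
  have "m \<in> E" if "c \<le> m" "m < d" for m
    using that
  proof (induction m rule: dec_induct)
    case base
    then show ?case using N[of c] PQ \<open>N \<le> c\<close> by auto
  next
    case (step m)
    then have "m \<in> E" by simp
    moreover have "Suc m \<notin> P \<union> Q"
      using no_centre_between[of k "Suc m"] step by (auto simp: P_def Q_def c_def d_def)
    ultimately show ?case
      using N[of "Suc m"] step \<open>N \<le> c\<close> by auto
  qed
  then have "d - 1 \<in> E" using \<open>c < d\<close> by simp
  then have "d \<in> Suc ` E \<inter> P"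
    using PQ \<open>c < d\<close> by (auto intro!: image_eqI[of _ _ "d - 1"])
  then show False
    using N[of d] \<open>N \<le> c\<close> \<open>c < d\<close> by auto
qed

section \<open>Assembly of the example and refutation of an extension\<close>

theorem theorem5p1:
  shows "\<exists>(A :: nat gorder) \<alpha> (B :: nat gorder) \<beta> \<iota> \<eta>.
    dynamical_system A \<alpha> \<and> countable (carrier A) \<and> incompressible A \<alpha> \<and>
    dynamical_system B \<beta> \<and> countable (carrier B) \<and> incompressible B \<beta> \<and>
    embedding A \<alpha> B \<beta> \<iota> \<and>
    embedding A \<alpha> (class_gorder :: pow_fin gorder) shift \<eta> \<and>
    \<not> (\<exists>\<eta>'. embedding B \<beta> (class_gorder :: pow_fin gorder) shift \<eta>' \<and>
          (\<forall>x\<in>carrier A. \<eta>' (\<iota> x) = \<eta> x))"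
proof -
  interpret A: countable_field algA by (rule countable_field_algA)
  interpret B: countable_field algB by (rule countable_field_algB)
  let ?\<alpha> = "A.enc \<circ> (-`) pred \<circ> A.dec" and ?\<beta> = "B.enc \<circ> (-`) pred \<circ> B.dec"
  let ?\<iota> = "B.enc \<circ> A.dec" and ?\<eta> = "abs_pow_fin \<circ> (-`) walk \<circ> A.dec"
  have no_ext: False
    if emb: "embedding (set_order algB) ?\<beta> class_gorder shift \<eta>'"
      and ext: "\<forall>x\<in>carrier (set_order algA). \<eta>' (?\<iota> x) = ?\<eta> x" for \<eta>'
  proof -
    define h where "h S = \<eta>' (B.enc S)" for S
    have h_Un: "h (S \<union> T) = Lattices.sup (h S) (h T)"
      and h_Int: "h (S \<inter> T) = Lattices.inf (h S) (h T)"
      and h_pred: "h (pred -` S) = shift (h S)" if "S \<in> algB" "T \<in> algB" for S T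
      using emb that
      by (auto simp: h_def embedding_def boolean_hom_def join_pres_def meet_pres_def
          B.carrier_set_order B.join_set_order B.meet_set_order)
    have h_empty: "h {} = Orderings.bot"
      using emb by (simp add: h_def embedding_def boolean_hom_def B.bottom_set_order)
    \<comment> \<open>The extension is prescribed on \<open>algA\<close>, in particular on the
      singletons; only its value at \<open>zigzag\<close> is unknown, and \<open>E\<close> will
      represent it.\<close>
    have h_walk: "h S = abs_pow_fin (walk -` S)" if "S \<in> algA" for S
      using ext that by (simp add: h_def A.carrier_set_order)
    have point: "{p} \<in> algA" for p
      by (auto simp: algA_def almost_def)
    have point': "{p} \<in> algB" for p
      using point algA_subset_algB by blast
    have "zigzag \<in> algB"
      by (auto simp: algB_def almost_def)
    then have zz: "zigzag \<in> algB" "pred -` zigzag \<in> algB"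
      by (simp_all add: vimage_pred_algB)
    obtain E where E: "h zigzag = abs_pow_fin E"
      by (metis Quotient_abs_rep[OF Quotient_pow_fin])
    have hE: "h (pred -` zigzag) = abs_pow_fin (Suc ` E)"
      by (simp add: h_pred[OF zz(1) zz(1)] E shift.abs_eq)
    \<comment> \<open>Moving \<open>zigzag\<close> forward removes \<open>(0, True)\<close> and adds
      \<open>(0, False)\<close>. Expressed by joins and meets, this passes through \<open>h\<close>
      to the hypotheses of \<open>no_lift\<close>.\<close>
    have "pred -` zigzag \<inter> {(0, True)} = {}" "zigzag \<inter> {(0, False)} = {}"
      "pred -` zigzag \<union> {(0, True)} = zigzag \<union> {(0, False)}"
      by (auto simp: zigzag_def pred_def split: if_splits)
    then have "Lattices.inf (h (pred -` zigzag)) (h {(0, True)}) = Orderings.bot"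
      "Lattices.inf (h zigzag) (h {(0, False)}) = Orderings.bot"
      "Lattices.sup (h (pred -` zigzag)) (h {(0, True)}) = Lattices.sup (h zigzag) (h {(0, False)})"
      by (simp_all add: h_Un[symmetric] h_Int[symmetric] zz point' h_empty)
    then show False
      by (intro no_lift[of E]) (simp_all add: hE E h_walk point inf_pow_fin.abs_eq
          sup_pow_fin.abs_eq bot_pow_fin_def pow_fin.abs_eq_iff)
  qed
  show ?thesis
  proof (intro exI conjI)
    show "dynamical_system (set_order algA) ?\<alpha>"
      using A.countable_field_axioms bij_pred vimage_pred_algA pred_algA
      by (rule dynamical_system_set_order)
    show "dynamical_system (set_order algB) ?\<beta>"
      using B.countable_field_axioms bij_pred vimage_pred_algB pred_algB
      by (rule dynamical_system_set_order)
    \<comment> \<open>Incompressibility is inherited from the larger algebra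
      \<open>algB\<close>.\<close>
    show "incompressible (set_order algA) ?\<alpha>"
      using vimage_pred_algA upward_closed_algB algA_subset_algB
      by (intro A.incompressible_set_order) auto
    show "incompressible (set_order algB) ?\<beta>"
      using vimage_pred_algB upward_closed_algB by (rule B.incompressible_set_order)
    show "embedding (set_order algA) ?\<alpha> (set_order algB) ?\<beta> ?\<iota>"
      using A.countable_field_axioms B.countable_field_axioms algA_subset_algB vimage_pred_algA
      by (rule embedding_set_order_subset)
    show "embedding (set_order algA) ?\<alpha> class_gorder shift ?\<eta>"
      using A.countable_field_axioms vimage_pred_algA infinite_walk almost_eq_walk
      by (rule embedding_set_order_pow_fin)
    show "\<not> (\<exists>\<eta>'. embedding (set_order algB) ?\<beta> class_gorder shift \<eta>' \<and>
        (\<forall>x\<in>carrier (set_order algA). \<eta>' (?\<iota> x) = ?\<eta> x))"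
      using no_ext by blast
  qed auto
qed

end
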